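(* Consider the source model in which all source symbols have the same length $L$, in the asymptotic regime described in the context. For modified fixed-length deduplication (mFLD) with first-stage parsing length $D=L$ and chunk length $\ell=\ell(B)$, if $\ell\ge\frac{\log(B/A)-2}{H(\delta)}$, then $$\mathbb{E}[\mathcal{L}_{mF}(\boldsymbol{s})]\ge\frac1{128}BL(1+o(1)),\qquad\text{as }B\to\infty,$$ where the $o(1)$ term is independent of $\delta$.
   Context: All logarithms are base 2. $H(p)=p\log\frac1p+(1-p)\log\frac1{1-p}$ is the binary entropy. Source model (equal symbol lengths). Parameters: positive integers $A,B,L$ and an edit probability $\delta$. Source symbols $X_1,\dots,X_A$ are drawn independently and uniformly from $\{0,1\}^L$ (with replacement). Then, independently for $b=1,\dots,B$, an index $J_b$ is drawn uniformly from $\{1,\dots,A\}$ and the source block $Y_b$ is obtained from $X_{J_b}$ by a $\delta$-edit, i.e. by flipping each bit independently with probability $\delta$. The data stream is $\boldsymbol{s}=Y_1Y_2\cdots Y_B$. Asymptotic regime. $B\to\infty$; $A$ and $L$ are functions of $B$ tending to infinity with $A\le B^{1-k_2}$ for a fixed $0<k_2<1$ and $L=\Theta(B^{k_1})$ for a fixed $k_1>0$; $\delta\in(0,\frac12)$ is constant (it does not vary with $B$). Dictionary encoding of a parsed string. Given a parsing of $\boldsymbol{s}$ into consecutive chunks, the encoding starts with a prefix-free (Elias gamma) encoding of $|\boldsymbol{s}|$. Chunks are then processed in order, starting with an empty dictionary. A chunk different from all previous chunks is encoded as the bit 1 followed by the chunk itself, and is entered into the dictionary. A chunk equal to an earlier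 one is encoded as the bit 0 followed by a pointer (index) to its dictionary entry; if the current dictionary has size $t$, the pointer takes $\lceil\log t\rceil$ bits. Modified fixed-length deduplication (mFLD) with first-stage parsing length $D$ and chunk length $\ell\le D$: $\boldsymbol{s}$ is parsed into consecutive segments of length $D$ (the last one possibly shorter), and each segment is parsed into consecutive chunks of length $\ell$ (the last chunk of a segment possibly shorter). The dictionary encoding is applied to the resulting chunks. $\mathcal{L}_{mF}(\boldsymbol{s})$ is the number of bits used to encode $\boldsymbol{s}$. *)

theory Defs
  imports "HOL-Probability.Probability" "HOL-Library.Log_Nat" "HOL-Library.Landau_Symbols"
begin

definition binary_entropy :: "real \<Rightarrow> real" where
  "binary_entropy p = p * log 2 (1 / p) + (1 - p) * log 2 (1 / (1 - p))"

definition source_symbols_pmf :: "nat \<Rightarrow> nat \<Rightarrow> bool list list pmf" where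
  "source_symbols_pmf A L = replicate_pmf A (pmf_of_set {x. length x = L})"

text \<open>The Bernoulli list \<open>z\<close> marks the positions to be flipped; on type bool, \<open>\<noteq>\<close> is exclusive or.\<close>

definition edit_pmf :: "real \<Rightarrow> bool list \<Rightarrow> bool list pmf" where
  "edit_pmf \<delta> x = map_pmf (\<lambda>z. map2 (\<noteq>) x z) (replicate_pmf (length x) (bernoulli_pmf \<delta>))"

definition source_block_pmf :: "real \<Rightarrow> bool list list \<Rightarrow> bool list pmf" where
  "source_block_pmf \<delta> xs = do {j \<leftarrow> pmf_of_set {..<length xs}; edit_pmf \<delta> (xs ! j)}"

definition source_stream_pmf :: "nat \<Rightarrow> nat \<Rightarrow> nat \<Rightarrow> real \<Rightarrow> bool list pmf" where
  "source_stream_pmf A B L \<delta> = do {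
     xs \<leftarrow> source_symbols_pmf A L;
     ys \<leftarrow> replicate_pmf B (source_block_pmf \<delta> xs);
     return_pmf (concat ys)}"

text \<open>The \<open>w\<close> least significant binary digits of \<open>n\<close>, most significant digit first.\<close>

definition binary_digits :: "nat \<Rightarrow> nat \<Rightarrow> bool list" where
  "binary_digits w n = map (bit n) (rev [0..<w])"

text \<open>For \<open>n > 0\<close>, \<^term>\<open>floorlog 2 n\<close> is \<open>\<lfloor>log\<^sub>2 n\<rfloor> + 1\<close>, the number of binary digits of \<open>n\<close>.\<close>

definition elias_gamma :: "nat \<Rightarrow> bool list" where
  "elias_gamma n = replicate (floorlog 2 n - 1) False @ binary_digits (floorlog 2 n) n"

definition dict_index :: "'a list \<Rightarrow> 'a \<Rightarrow> nat" where
  "dict_index d c = length (takeWhile (\<lambda>x. x \<noteq> c) d)"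

text \<open>The first argument is the current dictionary, in order of insertion. It is nonempty whenever
  a pointer is written, so the value of the logarithm at 0 is irrelevant.\<close>

fun encode_chunks :: "bool list list \<Rightarrow> bool list list \<Rightarrow> bool list" where
  "encode_chunks d [] = []"
| "encode_chunks d (c # cs) =
     (if c \<in> set d
      then False # binary_digits (nat \<lceil>log 2 (real (length d))\<rceil>) (dict_index d c) @ encode_chunks d cs
      else True # c @ encode_chunks (d @ [c]) cs)"

definition dictionary_encoding :: "bool list list \<Rightarrow> bool list" where
  "dictionary_encoding cs = elias_gamma (length (concat cs)) @ encode_chunks [] cs"

text \<open>Consecutive pieces of length \<open>n\<close>, the last one possibly shorter. To be total, the function
  treats \<open>n = 0\<close> as \<open>n = 1\<close>.\<close>

fun chunks :: "nat \<Rightarrow> 'a list \<Rightarrow> 'a list list" where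
  "chunks n [] = []"
| "chunks n (x # xs) = (x # take (n - 1) xs) # chunks n (drop (n - 1) xs)"

definition mFLD_parse :: "nat \<Rightarrow> nat \<Rightarrow> 'a list \<Rightarrow> 'a list list" where
  "mFLD_parse D l s = concat (map (chunks l) (chunks D s))"

definition mFLD_bits :: "nat \<Rightarrow> nat \<Rightarrow> bool list \<Rightarrow> nat" where
  "mFLD_bits D l s = length (dictionary_encoding (mFLD_parse D l s))"

definition expected_mFLD_bits :: "nat \<Rightarrow> nat \<Rightarrow> nat \<Rightarrow> real \<Rightarrow> nat \<Rightarrow> nat \<Rightarrow> real" where
  "expected_mFLD_bits A B L \<delta> D l =
     measure_pmf.expectation (source_stream_pmf A B L \<delta>) (\<lambda>s. real (mFLD_bits D l s))"

end

theory Submission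
  imports Defs "HOL-Real_Asymp.Real_Asymp"
begin

text \<open>Each segment is one source block, and it contains \<open>q = \<lfloor>L/\<ell>\<rfloor> \<ge> L/(2\<ell>)\<close> chunks of full length \<open>\<ell>\<close>.
  Call a chunk typical if at least \<open>\<ell>\<delta>\<close> of its bits are flipped; by the central limit theorem this
  has probability tending to \<open>1/2\<close>. A given typical flip pattern has probability at most
  \<open>2\<^sup>-\<^sup>\<ell>\<^sup>H \<le> 4A/B\<close>. Hence among the first \<open>B/8\<close> blocks, where a source symbol is used about
  \<open>B/(8A)\<close> times, a typical chunk collides with a chunk at the same position of the same source
  symbol with conditional probability at most \<open>1/2\<close>. Chunks of different origin agree with probability
  \<open>2\<^sup>-\<^sup>\<ell>\<close>. So any set of at most \<open>2\<^sup>\<ell>/32\<close> chunk positions in the first \<open>B/8\<close> blocks yields in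
  expectation a constant fraction of distinct chunks. If this set can contain all those positions, the
  distinct chunks alone, written out in full, cost enough. Otherwise, with constant probability, the
  dictionary has size at least \<open>2\<^sup>\<ell>\<^sup>-\<^sup>9\<close> after \<open>B/8\<close> blocks, and then every later full chunk costs at
  least \<open>\<ell> - 9\<close> bits, either literally or as a pointer. The constants leave slack, so the error
  term can be taken to be \<open>0\<close>.\<close>

subsection \<open>Independent repetition\<close>

text \<open>Independence of the coordinates; the marginals of \<open>replicate_pmf\<close> below are
  derived from this product formula. \<open>E\<close> is generalised because the induction splits
  off the head and shifts the events.\<close>

lemma measure_replicate_pmf_nth:
  "measure (replicate_pmf n p) {xs. \<forall>i<n. xs ! i \<in> E i} = (\<Prod>i<n. measure (measure_pmf p) (E i))"
proof (induction n arbitrary: E)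
  case 0
  then show ?case by simp
next
  case (Suc n)
  have "emeasure (replicate_pmf (Suc n) p) {xs. \<forall>i<Suc n. xs ! i \<in> E i} =
        (\<integral>\<^sup>+x. \<integral>\<^sup>+xs. indicator (E 0) x * indicator {xs. \<forall>i<n. xs ! i \<in> E (Suc i)} xs
           \<partial>measure_pmf (replicate_pmf n p) \<partial>measure_pmf p)"
    by (auto simp: All_less_Suc2 split: split_indicator intro!: nn_integral_cong)
  also have "\<dots> = emeasure p (E 0) * emeasure (replicate_pmf n p) {xs. \<forall>i<n. xs ! i \<in> E (Suc i)}"
    by (simp add: nn_integral_cmult nn_integral_multc)
  also have "\<dots> = ennreal (measure p (E 0) * (\<Prod>i<n. measure p (E (Suc i))))"
    by (simp add: measure_pmf.emeasure_eq_measure Suc.IH ennreal_mult prod_nonneg)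
  finally show ?case
    by (simp only: prod.lessThan_Suc_shift measure_pmf.emeasure_eq_measure)
      (simp add: prod_nonneg)
qed

lemma pmf_replicate_pmf:
  assumes "length z = n"
  shows "pmf (replicate_pmf n p) z = (\<Prod>i<n. pmf p (z ! i))"
proof -
  have "pmf (replicate_pmf n p) z = measure (replicate_pmf n p) {z}"
    by (simp add: measure_pmf_single)
  also have "\<dots> = measure (replicate_pmf n p) {xs. \<forall>i<n. xs ! i \<in> {z ! i}}"
    by (rule measure_pmf.finite_measure_eq_AE)
      (auto simp: AE_measure_pmf_iff set_replicate_pmf assms list_eq_iff_nth_eq)
  finally show ?thesis
    by (simp only: measure_replicate_pmf_nth measure_pmf_single)
qed

text \<open>Coordinates that are not selected are unconstrained and contribute a factor 1. The order
  of the selected ones is irrelevant, so pairs of coordinates, slices and pairs of disjoint slices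
  are all instances.\<close>

lemma map_nths_replicate_pmf:
  assumes "distinct is" "set is \<subseteq> {..<n}"
  shows "map_pmf (\<lambda>xs. map ((!) xs) is) (replicate_pmf n p) = replicate_pmf (length is) p"
proof (rule pmf_eqI)
  fix z
  show "pmf (map_pmf (\<lambda>xs. map ((!) xs) is) (replicate_pmf n p)) z = pmf (replicate_pmf (length is) p) z"
  proof (cases "length z = length is")
    case False
    then show ?thesis
      by (subst (1 2) pmf_eq_0_set_pmf[THEN iffD2]) (auto simp: set_replicate_pmf)
  next
    case True
    \<comment> \<open>The implication makes \<open>E i\<close> a singleton at a selected index and
      \<open>UNIV\<close> elsewhere, without inverting \<open>is\<close>.\<close>
    define E where "E i = {x. \<forall>t<length is. is ! t = i \<longrightarrow> x = z ! t}" for i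
    have Eset: "E (is ! t) = {z ! t}" if "t < length is" for t
      using that assms(1) by (auto simp: E_def nth_eq_iff_index_eq)
    have Eout: "E i = UNIV" if "i \<notin> set is" for i
      using that by (auto simp: E_def)
    have "pmf (map_pmf (\<lambda>xs. map ((!) xs) is) (replicate_pmf n p)) z =
        measure (replicate_pmf n p) {xs. \<forall>i<n. xs ! i \<in> E i}"
    proof -
      have "(\<lambda>xs. map ((!) xs) is) -` {z} = {xs. \<forall>i<n. xs ! i \<in> E i}"
      proof -
        have "is ! t < n" if "t < length is" for t
          using assms(2) that by (meson lessThan_iff nth_mem subsetD)
        then show ?thesis
          using True by (auto simp: E_def list_eq_iff_nth_eq)
      qed
      then show ?thesis by (simp add: pmf_map)
    qed
    also have "\<dots> = (\<Prod>i<n. measure p (E i))"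
      by (rule measure_replicate_pmf_nth)
    also have "\<dots> = (\<Prod>i\<in>set is. measure p (E i))"
      using assms(2) by (intro prod.mono_neutral_right) (auto simp: Eout)
    also have "\<dots> = (\<Prod>t<length is. measure p (E (is ! t)))"
      using assms(1) by (intro prod.reindex_bij_betw[symmetric] bij_betw_nth) auto
    also have "\<dots> = (\<Prod>t<length is. pmf p (z ! t))"
      by (intro prod.cong) (auto simp: Eset measure_pmf_single)
    finally show ?thesis
      using True by (simp add: pmf_replicate_pmf)
  qed
qed

lemma measurable_map_upt_PiM_measure_pmf:
  "(\<lambda>\<omega>. map \<omega> [0..<n]) \<in> measurable (PiM UNIV (\<lambda>_::nat. measure_pmf (p :: bool pmf))) (count_space UNIV)"
proof (induction n)
  case (Suc n)
  have "(\<lambda>\<omega>. \<omega> i) \<in> measurable (PiM UNIV (\<lambda>_::nat. measure_pmf p)) (count_space UNIV)" for i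
    by measurable
  with Suc show ?case by simp
qed simp

text \<open>The central limit theorem needs one infinite sequence of random variables on a common
  space; this transfers its conclusion back to finite lists. As \<open>bool list\<close> is
  countable, comparing singletons suffices.\<close>

lemma PiM_first_coordinates_measure_pmf:
  "distr (PiM UNIV (\<lambda>_::nat. measure_pmf p)) (count_space UNIV) (\<lambda>\<omega>. map \<omega> [0..<n]) =
   measure_pmf (replicate_pmf n (p :: bool pmf))"
  (is "distr ?M _ ?f = _")
proof (rule measure_eqI_countable)
  interpret product_prob_space "\<lambda>_::nat. measure_pmf p" UNIV
    by (intro product_prob_spaceI prob_space_measure_pmf)
  show "sets (distr ?M (count_space UNIV) ?f) = Pow UNIV" by simp
  show "sets (measure_pmf (replicate_pmf n p)) = Pow UNIV" by simp
  show "countable (UNIV :: bool list set)" by simp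
  fix z :: "bool list"
  have eq: "emeasure (distr ?M (count_space UNIV) ?f) {z} = emeasure ?M (?f -` {z} \<inter> space ?M)"
    by (rule emeasure_distr[OF measurable_map_upt_PiM_measure_pmf]) simp
  show "emeasure (distr ?M (count_space UNIV) ?f) {z} = emeasure (replicate_pmf n p) {z}"
  proof (cases "length z = n")
    case False
    then have "?f -` {z} \<inter> space ?M = {}" by auto
    moreover have "pmf (replicate_pmf n p) z = 0"
      using False by (auto simp: pmf_eq_0_set_pmf set_replicate_pmf)
    ultimately show ?thesis
      unfolding eq emeasure_pmf_single by (metis emeasure_empty ennreal_0)
  next
    case True
    have "?f -` {z} \<inter> space ?M = {\<omega> \<in> space ?M. \<forall>i\<in>{..<n}. \<omega> i \<in> {z ! i}}"
    proof -
      have "map \<omega> [0..<n] = z \<longleftrightarrow> (\<forall>i<n. \<omega> i = z ! i)" for \<omega>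
        unfolding list_eq_iff_nth_eq using True by simp
      then show ?thesis by (auto simp only: vimage_eq singleton_iff lessThan_iff)
    qed
    moreover have "emeasure ?M {\<omega> \<in> space ?M. \<forall>i\<in>{..<n}. \<omega> i \<in> {z ! i}} = (\<Prod>i<n. emeasure p {z ! i})"
      by (rule emeasure_PiM_Collect) auto
    moreover have "\<dots> = ennreal (pmf (replicate_pmf n p) z)"
      unfolding pmf_replicate_pmf[OF True] emeasure_pmf_single by (rule prod_ennreal) simp
    ultimately show ?thesis
      unfolding eq emeasure_pmf_single by metis
  qed
qed

subsection \<open>The number of flipped bits\<close>

lemma measure_std_normal_singleton: "measure std_normal_distribution {x} = 0"
proof -
  have "AE y in lborel. ennreal (std_normal_density y) * indicator {x} y = 0"
    using AE_lborel_singleton[of x] by eventually_elim (auto split: split_indicator)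
  then have "emeasure std_normal_distribution {x} = 0"
    by (simp add: emeasure_density nn_integral_0_iff_AE)
  then show ?thesis by (simp add: measure_def)
qed

text \<open>The density is even, so the two closed half-lines have equal mass, and the point 0 has
  mass zero.\<close>

lemma cdf_std_normal_0: "cdf std_normal_distribution 0 = 1 / 2"
proof -
  interpret real_distribution std_normal_distribution by (rule real_dist_normal_dist)
  have "emeasure std_normal_distribution {..0} =
      (\<integral>\<^sup>+x. ennreal (std_normal_density x) * indicator {..0} x \<partial>lborel)"
    by (simp add: emeasure_density)
  also have "\<dots> = (\<integral>\<^sup>+x. ennreal (std_normal_density x) * indicator {0..} x \<partial>lborel)"
    by (subst nn_integral_real_affine[where c = "-1" and t = 0])
      (auto simp: std_normal_density_def indicator_def intro!: nn_integral_cong)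
  also have "\<dots> = emeasure std_normal_distribution {0..}"
    by (simp add: emeasure_density)
  finally have sym: "prob {..0} = prob {0..}"
    by (simp add: measure_def)
  have "prob {..0::real} = prob {..<0} + prob {0}"
  proof -
    have "{..0::real} = {..<0} \<union> {0}" by auto
    then show ?thesis by (simp only:) (rule finite_measure_Union, auto)
  qed
  moreover have "prob {..<0::real} + prob {0..} = 1"
  proof -
    have "{..<0::real} \<union> {0..} = space std_normal_distribution" by auto
    then show ?thesis
      using prob_space by (subst finite_measure_Union[symmetric]) auto
  qed
  ultimately show ?thesis
    using sym by (simp add: cdf_def measure_std_normal_singleton)
qed

text \<open>The centred and normalised count converges weakly to a standard normal variable, so the
  probability of exceeding the mean tends to 1/2. The value 3/8 is a convenient constant below this
  limit.\<close>

lemma eventually_bernoulli_count_ge_mean: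
  assumes "0 < \<delta>" "\<delta> < 1"
  shows "\<forall>\<^sub>F n in sequentially. 3 / 8 \<le> measure (replicate_pmf n (bernoulli_pmf \<delta>))
    {z. real n * \<delta> \<le> real (length (filter id z))}"
proof -
  define p where "p = bernoulli_pmf \<delta>"
  define M where "M = PiM UNIV (\<lambda>_::nat. measure_pmf p)"
  define g where "g b = of_bool b - \<delta>" for b
  define X where "X i \<omega> = g (\<omega> i)" for i :: nat and \<omega> :: "nat \<Rightarrow> bool"
  interpret P: product_prob_space "\<lambda>_::nat. measure_pmf p" UNIV
    by (intro product_prob_spaceI prob_space_measure_pmf)
  interpret prob_space M
    unfolding M_def by (rule P.prob_space_axioms)
  have coord [measurable]: "(\<lambda>\<omega>. \<omega> i) \<in> measurable M (measure_pmf p)" for i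
    unfolding M_def by measurable
  have comp: "distr M (measure_pmf p) (\<lambda>\<omega>. \<omega> i) = measure_pmf p" for i
    unfolding M_def using P.PiM_component[of i] by simp
  have g [measurable]: "g \<in> measurable (measure_pmf p) borel" by simp
  \<comment> \<open>The joint law of all coordinates of \<open>M\<close> is \<open>M\<close> itself,
    which is the product of the marginals.\<close>
  have "indep_vars (\<lambda>_. measure_pmf p) (\<lambda>i \<omega>. \<omega> i) UNIV"
  proof (subst indep_vars_iff_distr_eq_PiM')
    have "distr M (PiM UNIV (\<lambda>_. measure_pmf p)) (\<lambda>x. \<lambda>i\<in>UNIV. x i) = distr M M (\<lambda>x. x)"
      unfolding M_def by (intro distr_cong) auto
    then show "distr M (PiM UNIV (\<lambda>_. measure_pmf p)) (\<lambda>x. \<lambda>i\<in>UNIV. x i) =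
        PiM UNIV (\<lambda>i. distr M (measure_pmf p) (\<lambda>\<omega>. \<omega> i))"
      by (simp add: comp distr_id2) (simp add: M_def)
  qed (use coord in simp_all)
  then have indep: "indep_vars (\<lambda>_. borel) X UNIV"
    unfolding X_def by (rule indep_vars_compose2[where Y = "\<lambda>_. g"]) simp
  have X_distr: "distr M borel (X i) = distr (measure_pmf p) borel g" for i
  proof -
    have "distr (measure_pmf p) borel g = distr (distr M (measure_pmf p) (\<lambda>\<omega>. \<omega> i)) borel g"
      by (simp add: comp)
    also have "\<dots> = distr M borel (g \<circ> (\<lambda>\<omega>. \<omega> i))"
      by (rule distr_distr[OF g coord])
    finally show ?thesis by (simp add: X_def[abs_def] comp_def)
  qed
  have E: "(\<integral>\<omega>. h (\<omega> i) \<partial>M) = (\<integral>b. h b \<partial>measure_pmf p)" for h :: "bool \<Rightarrow> real" and i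
    by (subst comp[of i, symmetric], subst integral_distr[OF coord]) auto
  have mean: "expectation (X i) = 0" for i
    unfolding X_def E using assms by (simp add: p_def g_def algebra_simps)
  have int: "integrable M (\<lambda>\<omega>. (X i \<omega>)\<^sup>2)" for i
  proof -
    have "integrable (distr M (measure_pmf p) (\<lambda>\<omega>. \<omega> i)) (\<lambda>b. (g b)\<^sup>2)"
      unfolding comp by (rule integrable_measure_pmf_finite) (rule finite)
    then show ?thesis
      unfolding X_def by (subst (asm) integrable_distr_eq[OF coord]) auto
  qed
  define \<sigma> where "\<sigma> = sqrt (\<delta> * (1 - \<delta>))"
  have \<sigma>: "\<sigma> > 0" "\<sigma>\<^sup>2 = \<delta> * (1 - \<delta>)" using assms by (auto simp: \<sigma>_def)
  have var: "variance (X i) = \<sigma>\<^sup>2" for i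
    unfolding mean \<sigma> unfolding X_def using E[of "\<lambda>b. (g b - 0)\<^sup>2" i] assms
    by (simp add: p_def g_def power2_eq_square algebra_simps)
  define D where "D n = distr M borel (\<lambda>x. (\<Sum>i<n. X i x) / sqrt (real n * \<sigma>\<^sup>2))" for n
  have "weak_conv_m D std_normal_distribution"
    unfolding D_def
    by (rule central_limit_theorem_zero_mean[OF indep mean \<sigma>(1) int var X_distr])
  moreover have "isCont (cdf std_normal_distribution) 0"
  proof -
    interpret N: real_distribution std_normal_distribution by (rule real_dist_normal_dist)
    show ?thesis by (simp add: N.isCont_cdf measure_std_normal_singleton)
  qed
  ultimately have "(\<lambda>n. cdf (D n) 0) \<longlonglongrightarrow> 1 / 2"
    by (simp add: weak_conv_m_def weak_conv_def flip: cdf_std_normal_0)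
  \<comment> \<open>The complementary event, a count strictly above the mean, then has probability
    more than 3/8.\<close>
  then have "\<forall>\<^sub>F n in sequentially. cdf (D n) 0 < 5 / 8"
    by (rule order_tendstoD) simp
  then show ?thesis
    using eventually_gt_at_top[of 0]
  proof eventually_elim
    case (elim n)
    have Xm [measurable]: "X i \<in> borel_measurable M" for i
      unfolding X_def[abs_def] by measurable
    have pos: "sqrt (real n * \<sigma>\<^sup>2) > 0" using elim \<sigma>(1) by simp
    have sumX: "(\<Sum>i<n. X i \<omega>) = real (length (filter id (map \<omega> [0..<n]))) - real n * \<delta>" for \<omega>
    proof (induction n)
      case (Suc n)
      then show ?case by (simp add: X_def g_def algebra_simps)
    qed simp
    have "cdf (D n) 0 = prob {\<omega> \<in> space M. (\<Sum>i<n. X i \<omega>) \<le> 0}"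
      unfolding cdf_def D_def using pos
      by (subst measure_distr) (auto simp: divide_le_0_iff vimage_def Int_def conj_commute)
    also have "\<dots> = 1 - prob {\<omega> \<in> space M. \<not> (\<Sum>i<n. X i \<omega>) \<le> 0}"
      by (subst prob_neg) auto
    finally have "3 / 8 \<le> prob {\<omega> \<in> space M. \<not> (\<Sum>i<n. X i \<omega>) \<le> 0}"
      using elim by simp
    also have "\<dots> \<le> prob {\<omega> \<in> space M. 0 \<le> (\<Sum>i<n. X i \<omega>)}"
      by (rule finite_measure_mono) auto
    also have "{\<omega> \<in> space M. 0 \<le> (\<Sum>i<n. X i \<omega>)} =
        (\<lambda>\<omega>. map \<omega> [0..<n]) -` {z. real n * \<delta> \<le> real (length (filter id z))} \<inter> space M"
      unfolding sumX by auto
    also have "prob \<dots> = measure (distr M (count_space UNIV) (\<lambda>\<omega>. map \<omega> [0..<n]))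
        {z. real n * \<delta> \<le> real (length (filter id z))}"
      unfolding M_def
      by (rule measure_distr[symmetric])
        (auto intro: measurable_map_upt_PiM_measure_pmf)
    finally show ?case
      by (simp add: M_def PiM_first_coordinates_measure_pmf p_def)
  qed
qed

subsection \<open>The dictionary encoding\<close>

text \<open>Gives direct access to the \<open>i\<close>-th chunk of a block. In contrast to
  \<open>chunks\<close>, it visibly commutes with \<open>map2\<close> and is a coordinate
  projection, so it can be applied to symbols and flip patterns separately.\<close>

definition piece :: "nat \<Rightarrow> nat \<Rightarrow> 'a list \<Rightarrow> 'a list" where
  "piece l i x = take l (drop (i * l) x)"

lemma length_piece: "Suc i * l \<le> length x \<Longrightarrow> length (piece l i x) = l"
  by (simp add: piece_def)

lemma piece_map2:
  "piece l i (map2 f x y) = map2 f (piece l i x) (piece l i y)"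
  by (simp add: piece_def drop_map take_map drop_zip take_zip)

lemma chunks_append: "length x = n \<Longrightarrow> 0 < n \<Longrightarrow> chunks n (x @ y) = x # chunks n y"
  by (cases x) auto

lemma chunks_concat:
  "0 < n \<Longrightarrow> (\<And>y. y \<in> set ys \<Longrightarrow> length y = n) \<Longrightarrow> chunks n (concat ys) = ys"
  by (induction ys) (auto simp: chunks_append)

text \<open>Only the first \<open>q\<close> full chunks matter for the lower bound; whatever follows
  them stays unevaluated.\<close>

lemma chunks_eq_pieces_append:
  "0 < n \<Longrightarrow> q * n \<le> length x \<Longrightarrow>
   chunks n x = map (\<lambda>i. piece n i x) [0..<q] @ chunks n (drop (q * n) x)"
proof (induction q arbitrary: x)
  case 0
  then show ?case by simp
next
  case (Suc q)
  have "chunks n x = chunks n (take n x @ drop n x)" by simp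
  also have "\<dots> = take n x # chunks n (drop n x)"
    using Suc.prems by (intro chunks_append) auto
  also have "chunks n (drop n x) =
      map (\<lambda>i. piece n i (drop n x)) [0..<q] @ chunks n (drop (q * n) (drop n x))"
    using Suc.prems by (intro Suc.IH) auto
  also have "map (\<lambda>i. piece n i (drop n x)) [0..<q] = map (\<lambda>i. piece n (Suc i) x) [0..<q]"
    by (simp add: piece_def add.commute)
  also have "take n x # (map (\<lambda>i. piece n (Suc i) x) [0..<q] @ chunks n (drop (q * n) (drop n x))) =
      map (\<lambda>i. piece n i x) [0..<Suc q] @ chunks n (drop (Suc q * n) x)"
  proof -
    have "map (\<lambda>i. piece n i x) [0..<Suc q] = piece n 0 x # map (\<lambda>i. piece n (Suc i) x) [0..<q]"
      unfolding map_upt_Suc by simp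
    then show ?thesis by (simp add: piece_def add.commute)
  qed
  finally show ?case .
qed

text \<open>The witness \<open>d'\<close> is the dictionary reached after \<open>cs\<close>. Its
  order is left open, since only the number of its entries is needed to bound pointer
  lengths.\<close>

lemma encode_chunks_append:
  "\<exists>d'. set d' = set d \<union> set cs \<and>
     (\<forall>cs'. encode_chunks d (cs @ cs') = encode_chunks d cs @ encode_chunks d' cs')"
proof (induction cs arbitrary: d)
  case Nil
  show ?case by (intro exI[of _ d]) simp
next
  case (Cons c cs)
  show ?case
  proof (cases "c \<in> set d")
    case True
    obtain d' where "set d' = set d \<union> set cs"
      "\<forall>cs'. encode_chunks d (cs @ cs') = encode_chunks d cs @ encode_chunks d' cs'"
      using Cons.IH by blast
    with True show ?thesis by (intro exI[of _ d']) auto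
  next
    case False
    obtain d' where "set d' = set (d @ [c]) \<union> set cs"
      "\<forall>cs'. encode_chunks (d @ [c]) (cs @ cs') = encode_chunks (d @ [c]) cs @ encode_chunks d' cs'"
      using Cons.IH by blast
    with False show ?thesis by (intro exI[of _ d']) auto
  qed
qed

text \<open>Every member of \<open>K\<close> is written out literally at its first occurrence. In
  the induction a chunk that enters the dictionary is removed from \<open>K\<close>, which keeps the
  two disjoint.\<close>

lemma length_encode_chunks_ge_distinct:
  assumes "\<And>c. c \<in> K \<Longrightarrow> length c = l" "K \<subseteq> set cs" "K \<inter> set d = {}"
  shows "l * card K \<le> length (encode_chunks d cs)"
  using assms
proof (induction cs arbitrary: d K)
  case Nil
  then show ?case by simp
next
  case (Cons c cs)
  have fin: "finite K" using Cons.prems(2) finite_subset by blast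
  show ?case
  proof (cases "c \<in> set d")
    case True
    then have "l * card K \<le> length (encode_chunks d cs)"
      using Cons.prems by (intro Cons.IH) auto
    with True show ?thesis by simp
  next
    case False
    have IH: "l * card (K - {c}) \<le> length (encode_chunks (d @ [c]) cs)"
      using Cons.prems by (intro Cons.IH) auto
    have "l * card K \<le> length c + l * card (K - {c})"
    proof (cases "c \<in> K")
      case True
      then have "card K = Suc (card (K - {c}))" using card.remove[OF fin True] by simp
      then show ?thesis using Cons.prems(1)[OF True] by simp
    qed simp
    with IH False show ?thesis by simp
  qed
qed

text \<open>The dictionary never shrinks, so each later pointer takes at least \<open>k\<close>
  bits, and a literal chunk of length \<open>l\<close> takes at least \<open>l \<ge> k\<close>
  bits.\<close>

lemma length_encode_chunks_ge_pointers:
  assumes "2 ^ k \<le> length d" "k \<le> l"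
  shows "k * length (filter (\<lambda>c. length c = l) cs) \<le> length (encode_chunks d cs)"
  using assms(1)
proof (induction cs arbitrary: d)
  case Nil
  then show ?case by simp
next
  case (Cons c cs)
  have "real k \<le> log 2 (real (length d))"
  proof -
    have "(2::real) ^ k \<le> real (length d)"
      using Cons.prems by (metis of_nat_le_iff of_nat_numeral of_nat_power)
    then show ?thesis by (simp add: le_log_of_power)
  qed
  then have k: "k \<le> nat \<lceil>log 2 (real (length d))\<rceil>" by linarith
  have "k * length (filter (\<lambda>c. length c = l) cs) \<le> length (encode_chunks d cs)"
    by (rule Cons.IH) (rule Cons.prems)
  moreover have "k * length (filter (\<lambda>c. length c = l) cs) \<le> length (encode_chunks (d @ [c]) cs)"
    by (rule Cons.IH) (use Cons.prems in simp)
  ultimately show ?case using k assms(2)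
    by (auto simp: binary_digits_def)
qed

section \<open>Cost of a stream made of blocks of length \<open>L\<close>\<close>

context
  fixes L l q :: nat and ys :: "bool list list"
  assumes L: "0 < L" and l: "0 < l" and q: "q * l \<le> L"
    and ys: "\<And>y. y \<in> set ys \<Longrightarrow> length y = L"
begin

lemma mFLD_parse_concat: "mFLD_parse L l (concat ys) = concat (map (chunks l) ys)"
  using L ys by (simp add: mFLD_parse_def chunks_concat)

lemma pieces_subset_chunks:
  assumes "S \<subseteq> {..<b0} \<times> {..<q}" "b0 \<le> length ys"
  shows "(\<lambda>(b, i). piece l i (ys ! b)) ` S \<subseteq> set (concat (map (chunks l) (take b0 ys)))"
proof clarsimp
  fix b i assume "(b, i) \<in> S"
  then have "b < b0" "i < q" using assms by auto
  moreover have "length (ys ! b) = L" using \<open>b < b0\<close> assms(2) ys by simp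
  ultimately have "piece l i (ys ! b) \<in> set (chunks l (take b0 ys ! b))"
    using q l by (subst chunks_eq_pieces_append[of l q]) auto
  then show "\<exists>y\<in>set (take b0 ys). piece l i (ys ! b) \<in> set (chunks l y)"
    using \<open>b < b0\<close> assms(2) by (intro bexI[of _ "take b0 ys ! b"] nth_mem) auto
qed

lemma length_pieces:
  assumes "S \<subseteq> {..<b0} \<times> {..<q}" "b0 \<le> length ys" "c \<in> (\<lambda>(b, i). piece l i (ys ! b)) ` S"
  shows "length c = l"
proof -
  obtain b i where "b < b0" "i < q" and c: "c = piece l i (ys ! b)" using assms by auto
  then have "Suc i * l \<le> L" using q by (meson Suc_leI le_trans mult_le_mono1)
  moreover have "length (ys ! b) = L" using \<open>b < b0\<close> assms(2) ys by simp
  ultimately show ?thesis unfolding c by (simp add: length_piece)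
qed

text \<open>First cost bound, used when \<open>S\<close> consists of all full chunk positions in the
  initial blocks: only literal chunks are counted.\<close>

lemma mFLD_bits_ge_distinct:
  assumes "S \<subseteq> {..<length ys} \<times> {..<q}"
  shows "l * card ((\<lambda>(b, i). piece l i (ys ! b)) ` S) \<le> mFLD_bits L l (concat ys)"
proof -
  have "l * card ((\<lambda>(b, i). piece l i (ys ! b)) ` S) \<le>
      length (encode_chunks [] (concat (map (chunks l) ys)))"
    using length_pieces[OF assms] pieces_subset_chunks[OF assms]
    by (intro length_encode_chunks_ge_distinct) auto
  then show ?thesis
    by (simp add: mFLD_bits_def dictionary_encoding_def mFLD_parse_concat)
qed

lemma length_filter_concat_chunks:
  assumes "\<And>y. y \<in> set zs \<Longrightarrow> length y = L"
  shows "q * length zs \<le> length (filter (\<lambda>c. length c = l) (concat (map (chunks l) zs)))"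
  using assms
proof (induction zs)
  case (Cons y zs)
  have "filter (\<lambda>c. length c = l) (map (\<lambda>i. piece l i y) [0..<q]) = map (\<lambda>i. piece l i y) [0..<q]"
  proof (rule filter_True)
    have "length (piece l i y) = l" if "i < q" for i
    proof -
      have "Suc i * l \<le> L" using q that by (meson Suc_leI le_trans mult_le_mono1)
      then show ?thesis using Cons.prems by (simp add: length_piece)
    qed
    then show "\<forall>c\<in>set (map (\<lambda>i. piece l i y) [0..<q]). length c = l" by auto
  qed
  then have "q \<le> length (filter (\<lambda>c. length c = l) (chunks l y))"
    using q l Cons.prems by (subst chunks_eq_pieces_append[of l q]) auto
  with Cons show ?case by simp
qed simp

text \<open>Second cost bound: the first \<open>b0\<close> blocks fill the dictionary with at least
  \<open>2 ^ k\<close> entries, and only the full chunks of the remaining blocks are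
  charged.\<close>

lemma mFLD_bits_ge_pointers:
  assumes "S \<subseteq> {..<b0} \<times> {..<q}" "b0 \<le> length ys" "k \<le> l"
    and "2 ^ k \<le> card ((\<lambda>(b, i). piece l i (ys ! b)) ` S)"
  shows "k * (q * (length ys - b0)) \<le> mFLD_bits L l (concat ys)"
proof -
  define cs where "cs = concat (map (chunks l) (take b0 ys))"
  define cs' where "cs' = concat (map (chunks l) (drop b0 ys))"
  have split: "concat (map (chunks l) ys) = cs @ cs'"
    unfolding cs_def cs'_def by (metis append_take_drop_id concat_append map_append)
  obtain d where d: "set d = set cs" "encode_chunks [] (cs @ cs') = encode_chunks [] cs @ encode_chunks d cs'"
    using encode_chunks_append[of "[]" cs] by auto
  \<comment> \<open>After the first \<open>b0\<close> blocks the dictionary contains every chunk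
    seen so far, in particular all pieces indexed by \<open>S\<close>.\<close>
  have "2 ^ k \<le> card (set d)"
    using assms(4) card_mono[OF _ pieces_subset_chunks[OF assms(1,2)]]
    unfolding d(1) cs_def by (meson List.finite_set le_trans)
  also have "\<dots> \<le> length d" by (rule card_length)
  finally have "k * length (filter (\<lambda>c. length c = l) cs') \<le> length (encode_chunks d cs')"
    using assms(3) by (rule length_encode_chunks_ge_pointers)
  moreover have "q * (length ys - b0) \<le> length (filter (\<lambda>c. length c = l) cs')"
    using length_filter_concat_chunks[of "drop b0 ys"] ys unfolding cs'_def
    by (metis in_set_dropD length_drop)
  ultimately have "k * (q * (length ys - b0)) \<le> length (encode_chunks d cs')"
    using mult_le_mono2 le_trans by blast
  then show ?thesis
    by (simp add: mFLD_bits_def dictionary_encoding_def mFLD_parse_concat split d(2))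
qed

end

subsection \<open>Projections and collisions of random bit lists\<close>

lemma pmf_replicate_bernoulli:
  assumes "0 < \<delta>" "\<delta> < 1"
  shows "pmf (replicate_pmf (length z) (bernoulli_pmf \<delta>)) z =
    2 powr (real (length (filter id z)) * log 2 \<delta> +
      (real (length z) - real (length (filter id z))) * log 2 (1 - \<delta>))"
  unfolding pmf_replicate_pmf[OF refl]
proof (induction z)
  case Nil
  then show ?case by simp
next
  case (Cons x z)
  have p: "pmf (bernoulli_pmf \<delta>) x = 2 powr (if x then log 2 \<delta> else log 2 (1 - \<delta>))"
    using assms by simp
  have "(\<Prod>i<length (x # z). pmf (bernoulli_pmf \<delta>) ((x # z) ! i)) =
      pmf (bernoulli_pmf \<delta>) x * (\<Prod>i<length z. pmf (bernoulli_pmf \<delta>) (z ! i))"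
    by (simp only: list.size add_Suc_right add_0_right prod.lessThan_Suc_shift nth_Cons_0 nth_Cons_Suc)
  also have "\<dots> = 2 powr (real (length (filter id (x # z))) * log 2 \<delta> +
      (real (length (x # z)) - real (length (filter id (x # z)))) * log 2 (1 - \<delta>))"
    unfolding Cons.IH p by (simp add: algebra_simps flip: powr_add)
  finally show ?case .
qed

text \<open>For \<open>\<delta> < 1 / 2\<close> each further flip makes a pattern less likely, and
  \<open>l * \<delta>\<close> flips would give exactly the exponent
  \<open>- l * binary_entropy \<delta>\<close>.\<close>

lemma pmf_replicate_bernoulli_le:
  assumes "0 < \<delta>" "\<delta> < 1 / 2" "length z = l" "real l * \<delta> \<le> real (length (filter id z))"
  shows "pmf (replicate_pmf l (bernoulli_pmf \<delta>)) z \<le> 2 powr (- real l * binary_entropy \<delta>)"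
proof -
  have "log 2 \<delta> \<le> log 2 (1 - \<delta>)" using assms by simp
  then have "(real (length (filter id z)) - real l * \<delta>) * log 2 \<delta> \<le>
      (real (length (filter id z)) - real l * \<delta>) * log 2 (1 - \<delta>)"
    using assms by (intro mult_left_mono) auto
  moreover have "real l * binary_entropy \<delta> =
      - (real l * \<delta>) * log 2 \<delta> - (real l - real l * \<delta>) * log 2 (1 - \<delta>)"
    using assms(1,2) by (simp add: binary_entropy_def log_divide algebra_simps)
  ultimately have "real (length (filter id z)) * log 2 \<delta> +
      (real (length z) - real (length (filter id z))) * log 2 (1 - \<delta>) \<le> - real l * binary_entropy \<delta>"
    using assms(3) by (simp add: algebra_simps)
  then show ?thesis
    using pmf_replicate_bernoulli[of \<delta> z] assms by simp
qed

text \<open>Integrates a conditional bound over the first component. The indicator of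
  \<open>T\<close> preserves the probability of the conditioning event as a factor.\<close>

lemma measure_pair_pmf_le:
  assumes "\<And>x. x \<in> set_pmf p \<Longrightarrow> measure (measure_pmf q) {y. (x, y) \<in> E} \<le> c * indicator T x" "0 \<le> c"
  shows "measure (pair_pmf p q) E \<le> c * measure (measure_pmf p) T"
proof -
  have "emeasure (pair_pmf p q) E = (\<integral>\<^sup>+x. \<integral>\<^sup>+y. indicator E (x, y) \<partial>q \<partial>p)"
    by (simp add: nn_integral_pair_pmf' flip: nn_integral_indicator)
  also have "\<dots> = (\<integral>\<^sup>+x. \<integral>\<^sup>+y. indicator {y. (x, y) \<in> E} y \<partial>q \<partial>p)"
    by (intro nn_integral_cong) (auto split: split_indicator)
  also have "\<dots> = (\<integral>\<^sup>+x. emeasure q {y. (x, y) \<in> E} \<partial>p)"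
    by simp
  also have "\<dots> \<le> (\<integral>\<^sup>+x. ennreal c * indicator T x \<partial>p)"
  proof (intro nn_integral_mono_AE, simp add: AE_measure_pmf_iff, intro ballI)
    fix x assume "x \<in> set_pmf p"
    from assms(1)[OF this] have "emeasure q {y. (x, y) \<in> E} \<le> ennreal (c * indicator T x)"
      by (simp only: measure_pmf.emeasure_eq_measure ennreal_leI)
    then show "emeasure q {y. (x, y) \<in> E} \<le> ennreal c * indicator T x"
      by (auto split: split_indicator)
  qed
  also have "\<dots> = ennreal (c * measure p T)"
    using assms(2) by (simp add: nn_integral_cmult measure_pmf.emeasure_eq_measure ennreal_mult)
  finally show ?thesis
    using assms(2) by (simp add: measure_pmf.emeasure_eq_measure)
qed

lemma measure_pair_pmf_le_swap:
  assumes "\<And>y. y \<in> set_pmf q \<Longrightarrow> measure (measure_pmf p) {x. (x, y) \<in> E} \<le> c" "0 \<le> c"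
  shows "measure (pair_pmf p q) E \<le> c"
proof -
  have "measure (pair_pmf p q) E = measure (pair_pmf q p) ((\<lambda>(x, y). (y, x)) -` E)"
    by (subst pair_commute_pmf) simp
  also have "\<dots> \<le> c * measure q UNIV"
    using assms by (intro measure_pair_pmf_le) auto
  finally show ?thesis by simp
qed

section \<open>Images and marginals of lists of independent entries\<close>

lemma map_replicate_pmf: "map_pmf (map f) (replicate_pmf n p) = replicate_pmf n (map_pmf f p)"
proof (induction n)
  case (Suc n)
  show ?case
    unfolding replicate_pmf.simps Suc.IH[symmetric]
    by (simp add: map_pmf_def bind_assoc_pmf bind_return_pmf)
qed simp

lemma map_nth_replicate_pmf:
  assumes "b < n"
  shows "map_pmf (\<lambda>xs. xs ! b) (replicate_pmf n p) = p"
proof -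
  have "map_pmf (\<lambda>xs. xs ! b) (replicate_pmf n p) = map_pmf hd (map_pmf (\<lambda>xs. map ((!) xs) [b]) (replicate_pmf n p))"
    by (simp add: map_pmf_comp)
  also have "\<dots> = map_pmf hd (replicate_pmf 1 p)"
    using assms by (subst map_nths_replicate_pmf) auto
  also have "\<dots> = p" by (simp only: replicate_pmf_1 map_pmf_comp) simp
  finally show ?thesis .
qed

lemma map_take_drop_replicate_pmf:
  "map_pmf (\<lambda>xs. (take m xs, drop m xs)) (replicate_pmf (m + n) p) =
   pair_pmf (replicate_pmf m p) (replicate_pmf n p)"
  unfolding replicate_pmf_distrib pair_pmf_def map_bind_pmf map_return_pmf
  by (intro bind_pmf_cong refl) (auto simp: set_replicate_pmf)

lemma map_nth_nth_replicate_pmf: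
  assumes "b < n" "b' < n" "b \<noteq> b'"
  shows "map_pmf (\<lambda>xs. (xs ! b, xs ! b')) (replicate_pmf n p) = pair_pmf p p"
proof -
  let ?f = "\<lambda>xs. (take 1 xs, drop 1 xs)"
  have "map_pmf (\<lambda>xs. (xs ! b, xs ! b')) (replicate_pmf n p) =
      map_pmf (\<lambda>(x, y). (hd x, hd y)) (map_pmf ?f (map_pmf (\<lambda>xs. map ((!) xs) [b, b']) (replicate_pmf n p)))"
    by (simp add: map_pmf_comp)
  also have "\<dots> = map_pmf (\<lambda>(x, y). (hd x, hd y)) (map_pmf ?f (replicate_pmf (1 + 1) p))"
    using assms by (subst map_nths_replicate_pmf) auto
  also have "\<dots> = pair_pmf p p"
    unfolding map_take_drop_replicate_pmf map_pair replicate_pmf_1 map_pmf_comp by simp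
  finally show ?thesis .
qed

lemma piece_eq_map_nth:
  assumes "Suc i * l \<le> length x"
  shows "piece l i x = map ((!) x) [i * l..<i * l + l]"
  using assms unfolding piece_def
  by (intro nth_equalityI) (auto simp: add.commute)

lemma map_piece_replicate_pmf:
  assumes "Suc i * l \<le> n"
  shows "map_pmf (piece l i) (replicate_pmf n p) = replicate_pmf l p"
proof -
  have "map_pmf (piece l i) (replicate_pmf n p) =
      map_pmf (\<lambda>x. map ((!) x) [i * l..<i * l + l]) (replicate_pmf n p)"
    using assms by (intro map_pmf_cong refl piece_eq_map_nth) (auto simp: set_replicate_pmf)
  also have "\<dots> = replicate_pmf l p"
    using assms by (subst map_nths_replicate_pmf) auto
  finally show ?thesis .
qed

text \<open>Pieces with different indices occupy disjoint sets of coordinates and are therefore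
  independent.\<close>

lemma map_piece_piece_replicate_pmf:
  assumes "Suc i * l \<le> n" "Suc i' * l \<le> n" "i \<noteq> i'"
  shows "map_pmf (\<lambda>x. (piece l i x, piece l i' x)) (replicate_pmf n p) =
    pair_pmf (replicate_pmf l p) (replicate_pmf l p)"
proof -
  let ?is = "[i * l..<i * l + l] @ [i' * l..<i' * l + l]"
  have dist: "distinct ?is"
  proof -
    have "Suc i * l \<le> i' * l \<or> Suc i' * l \<le> i * l"
      using assms(3) by (metis Suc_leI linorder_neqE_nat mult_le_mono1)
    then show ?thesis by auto
  qed
  have "map_pmf (\<lambda>x. (piece l i x, piece l i' x)) (replicate_pmf n p) =
      map_pmf (\<lambda>x. (map ((!) x) [i * l..<i * l + l], map ((!) x) [i' * l..<i' * l + l])) (replicate_pmf n p)"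
    using assms by (intro map_pmf_cong refl) (auto simp: set_replicate_pmf piece_eq_map_nth)
  also have "\<dots> = map_pmf (\<lambda>xs. (take l xs, drop l xs)) (map_pmf (\<lambda>x. map ((!) x) ?is) (replicate_pmf n p))"
    by (simp add: map_pmf_comp)
  also have "\<dots> = map_pmf (\<lambda>xs. (take l xs, drop l xs)) (replicate_pmf (l + l) p)"
    using assms dist by (subst map_nths_replicate_pmf) auto
  finally show ?thesis
    by (simp add: map_take_drop_replicate_pmf)
qed

text \<open>A uniform bit string consists of independent fair bits, so the marginal lemmas apply to
  source symbols too.\<close>

lemma pmf_of_set_length_eq:
  "pmf_of_set {x :: bool list. length x = n} = replicate_pmf n (pmf_of_set UNIV)"
proof (rule pmf_eqI)
  fix x :: "bool list"
  have fin: "finite {x :: bool list. length x = n}"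
    using finite_lists_length_eq[of "UNIV :: bool set" n] by simp
  have card: "card {x :: bool list. length x = n} = 2 ^ n"
    using card_lists_length_eq[of "UNIV :: bool set" n] by simp
  have ne: "{x :: bool list. length x = n} \<noteq> {}"
    using card by fastforce
  show "pmf (pmf_of_set {x :: bool list. length x = n}) x = pmf (replicate_pmf n (pmf_of_set UNIV)) x"
  proof (cases "length x = n")
    case True
    then show ?thesis
      using fin ne card by (simp add: pmf_replicate_pmf power_one_over)
  next
    case False
    then have "x \<notin> set_pmf (replicate_pmf n (pmf_of_set UNIV))"
      by (simp add: set_replicate_pmf)
    with False show ?thesis
      using fin ne by (simp add: pmf_eq_0_set_pmf)
  qed
qed

lemma xor_left_cancel:
  "length x = length z \<Longrightarrow> length y = length z \<Longrightarrow> map2 (\<noteq>) z x = map2 (\<noteq>) z y \<longleftrightarrow> x = (y :: bool list)"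
  by (auto simp: list_eq_iff_nth_eq)

text \<open>Once \<open>v\<close> is fixed, the equation determines \<open>u\<close> completely, and
  a uniform \<open>u\<close> takes that value with probability \<open>(1 / 2) ^ l\<close>.\<close>

lemma measure_xor_eq_le:
  fixes z z' :: "bool list"
  assumes "length z = l" "length z' = l"
  shows "measure (pair_pmf (replicate_pmf l (pmf_of_set UNIV)) (replicate_pmf l (pmf_of_set UNIV)))
     {(u, v). map2 (\<noteq>) u z = map2 (\<noteq>) v z'} \<le> (1 / 2) ^ l"
proof (rule measure_pair_pmf_le_swap)
  fix v :: "bool list"
  assume "v \<in> set_pmf (replicate_pmf l (pmf_of_set UNIV))"
  then have v: "length v = l" by (simp add: set_replicate_pmf)
  define w where "w = map2 (\<noteq>) (map2 (\<noteq>) v z') z"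
  have w: "length w = l" using assms v by (simp add: w_def)
  have "measure (replicate_pmf l (pmf_of_set UNIV)) {u. (u, v) \<in> {(u, v). map2 (\<noteq>) u z = map2 (\<noteq>) v z'}} \<le>
      measure (replicate_pmf l (pmf_of_set UNIV)) {w}"
    using assms v w
    by (intro measure_pmf.finite_measure_mono_AE)
      (auto simp: AE_measure_pmf_iff set_replicate_pmf w_def list_eq_iff_nth_eq)
  also have "\<dots> = (1 / 2) ^ l"
    using w by (simp add: measure_pmf_single pmf_replicate_pmf power_one_over)
  finally show "measure (replicate_pmf l (pmf_of_set UNIV)) {u. (u, v) \<in> {(u, v). map2 (\<noteq>) u z = map2 (\<noteq>) v z'}} \<le> (1 / 2) ^ l" .
qed simp

subsection \<open>The source\<close>

text \<open>The stream only determines the edited blocks; this finer space also records the source symbols,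
  the indices and the flip patterns.\<close>

definition source_space :: "nat \<Rightarrow> nat \<Rightarrow> nat \<Rightarrow> real \<Rightarrow> (bool list list \<times> (nat \<times> bool list) list) pmf" where
  "source_space A B L \<delta> = pair_pmf (source_symbols_pmf A L)
     (replicate_pmf B (pair_pmf (pmf_of_set {..<A}) (replicate_pmf L (bernoulli_pmf \<delta>))))"

definition xor_block :: "bool list list \<Rightarrow> nat \<times> bool list \<Rightarrow> bool list" where
  "xor_block xs w = map2 (\<noteq>) (xs ! fst w) (snd w)"

definition blocks :: "bool list list \<times> (nat \<times> bool list) list \<Rightarrow> bool list list" where
  "blocks \<omega> = map (xor_block (fst \<omega>)) (snd \<omega>)"

text \<open>The condition is one-sided because extra flips only lower the probability of a pattern
  when \<open>\<delta> < 1 / 2\<close>.\<close>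

definition typical :: "nat \<Rightarrow> real \<Rightarrow> bool list \<Rightarrow> bool" where
  "typical l \<delta> z \<longleftrightarrow> real l * \<delta> \<le> real (length (filter id z))"

lemma set_source_symbols_pmf:
  "xs \<in> set_pmf (source_symbols_pmf A L) \<Longrightarrow> length xs = A \<and> (\<forall>x\<in>set xs. length x = L)"
  unfolding source_symbols_pmf_def pmf_of_set_length_eq
  by (auto simp: set_replicate_pmf)

text \<open>All source symbols have length \<open>L\<close>, so the law of the flip pattern does not
  depend on the index drawn, and both can be drawn as an independent pair.\<close>

lemma source_stream_pmf_eq:
  assumes "0 < A"
  shows "source_stream_pmf A B L \<delta> = map_pmf (\<lambda>\<omega>. concat (blocks \<omega>)) (source_space A B L \<delta>)"
proof -
  let ?W = "pair_pmf (pmf_of_set {..<A}) (replicate_pmf L (bernoulli_pmf \<delta>))"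
  have block: "source_block_pmf \<delta> xs = map_pmf (xor_block xs) ?W"
    if "xs \<in> set_pmf (source_symbols_pmf A L)" for xs
  proof -
    have "length (xs ! j) = L" if "j < A" for j
      using set_source_symbols_pmf[OF \<open>xs \<in> _\<close>] that by simp
    then show ?thesis
      using set_source_symbols_pmf[OF that] assms
      unfolding source_block_pmf_def edit_pmf_def pair_pmf_def map_bind_pmf
      by (intro bind_pmf_cong) (auto simp: xor_block_def map_pmf_def bind_assoc_pmf bind_return_pmf lessThan_empty_iff)
  qed
  have "source_stream_pmf A B L \<delta> = bind_pmf (source_symbols_pmf A L)
      (\<lambda>xs. map_pmf (\<lambda>ws. concat (map (xor_block xs) ws)) (replicate_pmf B ?W))"
    unfolding source_stream_pmf_def
    by (intro bind_pmf_cong refl)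
      (simp add: block map_pmf_comp flip: map_replicate_pmf map_pmf_def)
  then show ?thesis
    by (simp add: source_space_def pair_pmf_def blocks_def map_bind_pmf map_pmf_def bind_assoc_pmf bind_return_pmf)
qed

text \<open>Makes every real function on the space integrable.\<close>

lemma finite_set_source_space:
  assumes "0 < A"
  shows "finite (set_pmf (source_space A B L \<delta>))"
proof -
  have fin: "finite (set_pmf (replicate_pmf n p))" if "finite (set_pmf p)" for n and p :: "'b pmf"
    using finite_lists_length_eq[OF that, of n] by (simp add: set_replicate_pmf lists_eq_set)
  show ?thesis
    unfolding source_space_def source_symbols_pmf_def pmf_of_set_length_eq
    using assms by (auto intro!: fin finite_cartesian_product simp: set_pmf_of_set lessThan_empty_iff)
qed

lemma set_source_space:
  assumes "\<omega> \<in> set_pmf (source_space A B L \<delta>)" "0 < A"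
  shows "length (fst \<omega>) = A" "\<And>j. j < A \<Longrightarrow> length (fst \<omega> ! j) = L" "length (snd \<omega>) = B"
    "\<And>b. b < B \<Longrightarrow> fst (snd \<omega> ! b) < A" "\<And>b. b < B \<Longrightarrow> length (snd (snd \<omega> ! b)) = L"
proof -
  have 1: "fst \<omega> \<in> set_pmf (source_symbols_pmf A L)"
    and 2: "snd \<omega> \<in> set_pmf (replicate_pmf B (pair_pmf (pmf_of_set {..<A}) (replicate_pmf L (bernoulli_pmf \<delta>))))"
    using assms(1) by (auto simp: source_space_def)
  show "length (fst \<omega>) = A" "\<And>j. j < A \<Longrightarrow> length (fst \<omega> ! j) = L"
    using set_source_symbols_pmf[OF 1] by auto
  show len: "length (snd \<omega>) = B" using 2 by (simp add: set_replicate_pmf)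
  fix b assume "b < B"
  then have "snd \<omega> ! b \<in> set (snd \<omega>)" using len by simp
  moreover have "set (snd \<omega>) \<subseteq> {..<A} \<times> {z. length z = L}"
    using 2 assms(2) by (auto simp: set_replicate_pmf set_pmf_of_set lessThan_empty_iff)
  ultimately show "fst (snd \<omega> ! b) < A" "length (snd (snd \<omega> ! b)) = L" by auto
qed

lemma length_blocks:
  assumes "\<omega> \<in> set_pmf (source_space A B L \<delta>)" "0 < A"
  shows "length (blocks \<omega>) = B" "y \<in> set (blocks \<omega>) \<Longrightarrow> length y = L"
    "b < B \<Longrightarrow> blocks \<omega> ! b = xor_block (fst \<omega>) (snd \<omega> ! b)"
proof -
  note \<omega> = set_source_space[OF assms]
  show "length (blocks \<omega>) = B" "b < B \<Longrightarrow> blocks \<omega> ! b = xor_block (fst \<omega>) (snd \<omega> ! b)"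
    using \<omega>(3) by (simp_all add: blocks_def)
  assume "y \<in> set (blocks \<omega>)"
  then obtain b where "b < B" "y = xor_block (fst \<omega>) (snd \<omega> ! b)"
    using \<omega>(3) by (auto simp: blocks_def in_set_conv_nth)
  then show "length y = L"
    using \<omega>(2)[OF \<omega>(4)] \<omega>(5) by (simp add: xor_block_def)
qed

text \<open>The two pieces come either from disjoint positions of one symbol or from two independent
  symbols.\<close>

lemma map_piece_piece_source_symbols_pmf:
  assumes "j < A" "j' < A" "Suc i * l \<le> L" "Suc i' * l \<le> L" "(i, j) \<noteq> (i', j')"
  shows "map_pmf (\<lambda>xs. (piece l i (xs ! j), piece l i' (xs ! j'))) (source_symbols_pmf A L) =
    pair_pmf (replicate_pmf l (pmf_of_set UNIV)) (replicate_pmf l (pmf_of_set UNIV))"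
proof (cases "j = j'")
  case True
  then have "i \<noteq> i'" using assms by simp
  have "map_pmf (\<lambda>xs. (piece l i (xs ! j), piece l i' (xs ! j'))) (source_symbols_pmf A L) =
      map_pmf (\<lambda>x. (piece l i x, piece l i' x)) (map_pmf (\<lambda>xs. xs ! j) (source_symbols_pmf A L))"
    using True by (simp add: map_pmf_comp)
  then show ?thesis
    unfolding source_symbols_pmf_def pmf_of_set_length_eq map_nth_replicate_pmf[OF assms(1)]
    using map_piece_piece_replicate_pmf[OF assms(3,4) \<open>i \<noteq> i'\<close>] by simp
next
  case False
  have "map_pmf (\<lambda>xs. (piece l i (xs ! j), piece l i' (xs ! j'))) (source_symbols_pmf A L) =
      map_pmf (\<lambda>(x, y). (piece l i x, piece l i' y)) (map_pmf (\<lambda>xs. (xs ! j, xs ! j')) (source_symbols_pmf A L))"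
    by (simp add: map_pmf_comp)
  then show ?thesis
    unfolding source_symbols_pmf_def pmf_of_set_length_eq map_nth_nth_replicate_pmf[OF assms(1,2) False]
    by (simp add: map_pair map_piece_replicate_pmf[OF assms(3)] map_piece_replicate_pmf[OF assms(4)])
qed

text \<open>The origin of a chunk is its piece index together with its symbol index. Conditionally
  on all indices and flip patterns, chunks of different origin are independent uniform strings xored
  with fixed patterns. The case \<open>b = b'\<close> is included.\<close>

lemma prob_different_origin_collision_le:
  assumes "0 < A" "b < B" "b' < B" "Suc i * l \<le> L" "Suc i' * l \<le> L"
  shows "measure (source_space A B L \<delta>) {\<omega>. piece l i (blocks \<omega> ! b) = piece l i' (blocks \<omega> ! b') \<and>
     (i, fst (snd \<omega> ! b)) \<noteq> (i', fst (snd \<omega> ! b'))} \<le> (1 / 2) ^ l" (is "measure _ ?E \<le> _")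
  unfolding source_space_def
proof (rule measure_pair_pmf_le_swap)
  fix ws assume ws: "ws \<in> set_pmf (replicate_pmf B (pair_pmf (pmf_of_set {..<A}) (replicate_pmf L (bernoulli_pmf \<delta>))))"
  have len: "length ws = B" using ws by (simp add: set_replicate_pmf)
  have "set ws \<subseteq> {..<A} \<times> {z. length z = L}"
    using ws assms(1) by (auto simp: set_replicate_pmf set_pmf_of_set lessThan_empty_iff)
  then have mem: "ws ! b \<in> {..<A} \<times> {z. length z = L}" "ws ! b' \<in> {..<A} \<times> {z. length z = L}"
    using assms(2,3) len by (meson nth_mem subsetD)+
  then obtain j z j' z' where w: "ws ! b = (j, z)" "ws ! b' = (j', z')"
    and j: "j < A" "j' < A" and z: "length z = L" "length z' = L" by force
  let ?X = "source_symbols_pmf A L"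
  show "measure ?X {xs. (xs, ws) \<in> ?E} \<le> (1 / 2) ^ l"
  proof (cases "(i, j) = (i', j')")
    case True
    then show ?thesis by (simp add: w)
  next
    case False
    let ?C = "{(u, v). map2 (\<noteq>) u (piece l i z) = map2 (\<noteq>) v (piece l i' z')}"
    have "{xs. (xs, ws) \<in> ?E} = (\<lambda>xs. (piece l i (xs ! j), piece l i' (xs ! j'))) -` ?C"
      using assms(2,3) len False by (auto simp: blocks_def w xor_block_def piece_map2)
    then have "measure ?X {xs. (xs, ws) \<in> ?E} =
        measure (map_pmf (\<lambda>xs. (piece l i (xs ! j), piece l i' (xs ! j'))) ?X) ?C"
      by simp
    also have "\<dots> \<le> (1 / 2) ^ l"
      unfolding map_piece_piece_source_symbols_pmf[OF j assms(4,5) False]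
      using z assms by (intro measure_xor_eq_le) (auto simp: length_piece)
    finally show ?thesis .
  qed
qed simp

lemma prob_typical:
  assumes "b < B" "Suc i * l \<le> L"
  shows "measure (source_space A B L \<delta>) {\<omega>. typical l \<delta> (piece l i (snd (snd \<omega> ! b)))} =
    measure (replicate_pmf l (bernoulli_pmf \<delta>)) {z. typical l \<delta> z}"
proof -
  have "map_pmf (\<lambda>\<omega>. piece l i (snd (snd \<omega> ! b))) (source_space A B L \<delta>) =
      map_pmf (piece l i) (map_pmf snd (map_pmf (\<lambda>ws. ws ! b) (map_pmf snd (source_space A B L \<delta>))))"
    by (simp add: map_pmf_comp)
  also have "\<dots> = replicate_pmf l (bernoulli_pmf \<delta>)"
    unfolding source_space_def map_snd_pair_pmf map_nth_replicate_pmf[OF assms(1)]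
    by (rule map_piece_replicate_pmf[OF assms(2)])
  finally show ?thesis
    by (simp flip: \<open>_ = replicate_pmf l _\<close> add: vimage_def)
qed

text \<open>Given block \<open>b\<close> with a typical pattern, block \<open>b'\<close> must hit
  the same symbol, with probability \<open>1 / A\<close>, and repeat that pattern, with probability
  at most \<open>2 powr (- l * binary_entropy \<delta>)\<close>. The probability of being typical
  survives as a factor.\<close>

lemma prob_same_origin_collision_le:
  assumes "0 < A" "0 < \<delta>" "\<delta> < 1 / 2" "b < B" "b' < B" "b \<noteq> b'" "Suc i * l \<le> L"
  shows "measure (source_space A B L \<delta>) {\<omega>. typical l \<delta> (piece l i (snd (snd \<omega> ! b))) \<and>
      fst (snd \<omega> ! b) = fst (snd \<omega> ! b') \<and> piece l i (snd (snd \<omega> ! b)) = piece l i (snd (snd \<omega> ! b'))}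
    \<le> 2 powr (- real l * binary_entropy \<delta>) / real A *
       measure (replicate_pmf l (bernoulli_pmf \<delta>)) {z. typical l \<delta> z}"
proof -
  define N where "N = replicate_pmf L (bernoulli_pmf \<delta>)"
  define W where "W = pair_pmf (pmf_of_set {..<A}) N"
  define h where "h = 2 powr (- real l * binary_entropy \<delta>)"
  have h: "0 \<le> h" by (simp add: h_def)
  let ?E = "{(w, w'). typical l \<delta> (piece l i (snd w)) \<and> fst w = fst w' \<and> piece l i (snd w) = piece l i (snd w')}"
  have "map_pmf (\<lambda>\<omega>. (snd \<omega> ! b, snd \<omega> ! b')) (source_space A B L \<delta>) =
      map_pmf (\<lambda>ws. (ws ! b, ws ! b')) (map_pmf snd (source_space A B L \<delta>))"
    by (simp add: map_pmf_comp)
  also have "\<dots> = pair_pmf W W"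
    unfolding source_space_def map_snd_pair_pmf map_nth_nth_replicate_pmf[OF assms(4,5,6)] W_def N_def ..
  finally have "measure (source_space A B L \<delta>) {\<omega>. typical l \<delta> (piece l i (snd (snd \<omega> ! b))) \<and>
      fst (snd \<omega> ! b) = fst (snd \<omega> ! b') \<and> piece l i (snd (snd \<omega> ! b)) = piece l i (snd (snd \<omega> ! b'))}
     = measure (pair_pmf W W) ?E"
    by (simp flip: \<open>_ = pair_pmf W W\<close> add: vimage_def)
  also have "\<dots> \<le> h / real A * measure W {w. typical l \<delta> (piece l i (snd w))}"
  proof (rule measure_pair_pmf_le)
    fix w assume "w \<in> set_pmf W"
    obtain j z where w: "w = (j, z)" by force
    have z: "length z = L" "j < A"
      using \<open>w \<in> _\<close> assms(1) by (auto simp: w W_def N_def set_replicate_pmf set_pmf_of_set lessThan_empty_iff)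
    show "measure W {w'. (w, w') \<in> ?E} \<le> h / real A * indicator {w. typical l \<delta> (piece l i (snd w))} w"
    proof (cases "typical l \<delta> (piece l i z)")
      case False
      then show ?thesis by (simp add: w)
    next
      case True
      have "measure N {z'. piece l i z = piece l i z'} = pmf (map_pmf (piece l i) N) (piece l i z)"
        unfolding pmf_map by (rule arg_cong[where f = "measure N"]) auto
      also have "\<dots> \<le> h"
        unfolding N_def map_piece_replicate_pmf[OF assms(7)] h_def
        using True z assms by (intro pmf_replicate_bernoulli_le) (auto simp: typical_def length_piece)
      finally have N: "measure N {z'. piece l i z = piece l i z'} \<le> h" .
      have "measure W {w'. (w, w') \<in> ?E} \<le> h * measure (pmf_of_set {..<A}) {j}"
        unfolding W_def
      proof (rule measure_pair_pmf_le)
        fix j'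
        show "measure N {z'. (j', z') \<in> {w'. (w, w') \<in> ?E}} \<le> h * indicator {j} j'"
          using N True by (cases "j' = j") (auto simp: w)
      qed (rule h)
      also have "measure (pmf_of_set {..<A}) {j} = 1 / real A"
        using z(2) by (subst measure_pmf_of_set) auto
      finally show ?thesis using True by (simp add: w)
    qed
  qed (use h in simp)
  also have "measure W {w. typical l \<delta> (piece l i (snd w))} =
      measure (map_pmf (piece l i) (map_pmf snd W)) {z. typical l \<delta> z}"
    by (simp add: vimage_def)
  also have "map_pmf (piece l i) (map_pmf snd W) = replicate_pmf l (bernoulli_pmf \<delta>)"
    unfolding W_def N_def map_snd_pair_pmf by (rule map_piece_replicate_pmf[OF assms(7)])
  finally show ?thesis by (simp add: h_def)
qed

text \<open>If the origins agree, the common symbol piece cancels from the xor and the flip patterns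
  must coincide. This requires equal piece indices, hence different blocks.\<close>

lemma prob_collision_le:
  assumes "0 < A" "0 < \<delta>" "\<delta> < 1 / 2" "b < B" "b' < B" "(b, i) \<noteq> (b', i')"
    and "Suc i * l \<le> L" "Suc i' * l \<le> L"
  shows "measure (source_space A B L \<delta>) {\<omega>. typical l \<delta> (piece l i (snd (snd \<omega> ! b))) \<and>
      piece l i (blocks \<omega> ! b) = piece l i' (blocks \<omega> ! b')}
    \<le> (1 / 2) ^ l + of_bool (i' = i) * (2 powr (- real l * binary_entropy \<delta>) / real A *
       measure (replicate_pmf l (bernoulli_pmf \<delta>)) {z. typical l \<delta> z})"
    (is "measure (measure_pmf ?M) ?E \<le> _ + _ * ?r")
proof -
  let ?D = "{\<omega>. piece l i (blocks \<omega> ! b) = piece l i' (blocks \<omega> ! b') \<and>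
     (i, fst (snd \<omega> ! b)) \<noteq> (i', fst (snd \<omega> ! b'))}"
  let ?S = "if i' = i then {\<omega>. typical l \<delta> (piece l i (snd (snd \<omega> ! b))) \<and>
      fst (snd \<omega> ! b) = fst (snd \<omega> ! b') \<and> piece l i (snd (snd \<omega> ! b)) = piece l i (snd (snd \<omega> ! b'))}
    else {}"
  have "\<omega> \<in> ?D \<union> ?S" if \<omega>: "\<omega> \<in> set_pmf ?M" and E: "\<omega> \<in> ?E" for \<omega>
  proof (cases "(i, fst (snd \<omega> ! b)) = (i', fst (snd \<omega> ! b'))")
    case False
    then show ?thesis using E by simp
  next
    case True
    define x where "x = piece l i (fst \<omega> ! fst (snd \<omega> ! b))"
    note len = set_source_space[OF \<omega> assms(1)]
    have "length x = l" "length (piece l i (snd (snd \<omega> ! b))) = l" "length (piece l i (snd (snd \<omega> ! b'))) = l"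
      using len assms by (auto simp: x_def intro!: length_piece)
    moreover have "map2 (\<noteq>) x (piece l i (snd (snd \<omega> ! b))) = map2 (\<noteq>) x (piece l i (snd (snd \<omega> ! b')))"
      using E True assms
      by (simp add: length_blocks(3)[OF \<omega> assms(1)] xor_block_def piece_map2 x_def)
    ultimately have "piece l i (snd (snd \<omega> ! b)) = piece l i (snd (snd \<omega> ! b'))"
      by (subst (asm) xor_left_cancel) auto
    then show ?thesis using E True by simp
  qed
  then have "measure ?M ?E \<le> measure ?M (?D \<union> ?S)"
    by (intro measure_pmf.finite_measure_mono_AE) (auto simp only: AE_measure_pmf_iff sets_measure_pmf UNIV_I)
  also have "\<dots> \<le> measure ?M ?D + measure ?M ?S"
    by (rule measure_Un_le) auto
  also have "measure ?M ?D \<le> (1 / 2) ^ l"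
    using assms by (intro prob_different_origin_collision_le) auto
  also have "measure ?M ?S \<le> of_bool (i' = i) * ?r"
    using prob_same_origin_collision_le[of A \<delta> b B b' i l L] assms by auto
  finally show ?thesis by simp
qed

text \<open>The right-hand side is bounded below by the expected number of typical pieces that differ from all others.\<close>

lemma expectation_distinct_pieces_ge:
  assumes "0 < A" "0 < \<delta>" "\<delta> < 1 / 2" "q * l \<le> L" "b0 \<le> B" "S \<subseteq> {..<b0} \<times> {..<q}"
  defines "p \<equiv> measure (replicate_pmf l (bernoulli_pmf \<delta>)) {z. typical l \<delta> z}"
  shows "real (card S) * (p * (1 - real b0 / real A * 2 powr (- real l * binary_entropy \<delta>)) - real (card S) * (1 / 2) ^ l)
    \<le> measure_pmf.expectation (source_space A B L \<delta>)
        (\<lambda>\<omega>. real (card ((\<lambda>(b, i). piece l i (blocks \<omega> ! b)) ` S)))"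
proof -
  let ?M = "source_space A B L \<delta>"
  define c where "c \<omega> = (\<lambda>(b, i). piece l i (blocks \<omega> ! b))" for \<omega>
  define typ_set where "typ_set s = {\<omega> :: bool list list \<times> (nat \<times> bool list) list. typical l \<delta> (piece l (snd s) (snd (snd \<omega> ! fst s)))}" for s

  \<comment> \<open>Isolated positions carry pairwise different pieces, so their number bounds the
    number of distinct pieces from below.\<close>
  define isolated where "isolated s = {\<omega> \<in> typ_set s. \<forall>s'\<in>S - {s}. c \<omega> s' \<noteq> c \<omega> s}" for s
  \<comment> \<open>The bound for one same-origin collision. It contains the factor
    \<open>p\<close>, so that the sum over all blocks can be compared with \<open>p\<close>
    itself.\<close>
  define r where "r = 2 powr (- real l * binary_entropy \<delta>) / real A * p"
  have r: "0 \<le> r" by (simp add: r_def p_def)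
  have fin: "finite S" using assms(6) finite_subset by blast
  have S: "fst s < b0" "fst s < B" "Suc (snd s) * l \<le> L" if "s \<in> S" for s
  proof -
    have "fst s < b0" "snd s < q" using that assms(6) by auto
    moreover have "Suc (snd s) * l \<le> q * l" using \<open>snd s < q\<close> by (intro mult_le_mono1) simp
    ultimately show "fst s < b0" "fst s < B" "Suc (snd s) * l \<le> L" using assms(4,5) by simp_all
  qed
  have iso: "p - real (card S) * (1 / 2) ^ l - real b0 * r \<le> measure ?M (isolated s)" if "s \<in> S" for s
  proof -
    \<comment> \<open>A typical position is either isolated or collides with another position of
      \<open>S\<close>; the latter is handled by a union bound.\<close>
    define coll where "coll s' = {\<omega> \<in> typ_set s. c \<omega> s = c \<omega> s'}" for s'
    have "p = measure ?M (typ_set s)"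
      unfolding typ_set_def p_def using S[OF that] by (subst prob_typical) auto
    also have "\<dots> \<le> measure ?M (isolated s \<union> (\<Union>s'\<in>S - {s}. coll s'))"
      by (rule measure_pmf.finite_measure_mono) (auto simp: isolated_def coll_def eq_commute)
    also have "\<dots> \<le> measure ?M (isolated s) + measure ?M (\<Union>s'\<in>S - {s}. coll s')"
      by (rule measure_Un_le) auto
    also have "measure ?M (\<Union>s'\<in>S - {s}. coll s') \<le> (\<Sum>s'\<in>S - {s}. measure ?M (coll s'))"
      using fin by (intro measure_pmf.finite_measure_subadditive_finite) auto
    also have "\<dots> \<le> (\<Sum>s'\<in>S - {s}. (1 / 2) ^ l + of_bool (snd s' = snd s) * r)"
    proof (rule sum_mono)
      fix s' assume s': "s' \<in> S - {s}"
      show "measure ?M (coll s') \<le> (1 / 2) ^ l + of_bool (snd s' = snd s) * r"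
        using prob_collision_le[OF assms(1-3) S(2)[OF that] S(2)[of s'] _ S(3)[OF that] S(3)[of s']] s'
        unfolding coll_def typ_set_def c_def case_prod_unfold r_def p_def mem_Collect_eq
        by (metis DiffE insertCI prod.collapse)
    qed
    also have "\<dots> = real (card (S - {s})) * (1 / 2) ^ l + real (card {s' \<in> S - {s}. snd s' = snd s}) * r"
      using fin by (simp add: sum.distrib sum_distrib_right[symmetric] Int_def)
    also have "\<dots> \<le> real (card S) * (1 / 2) ^ l + real b0 * r"
    proof (intro add_mono mult_right_mono)
      show "real (card (S - {s})) \<le> real (card S)" using fin by (simp add: card_mono)
      \<comment> \<open>Each block has only one position with a given piece index, so at most
        \<open>b0\<close> positions can share the origin of \<open>s\<close>.\<close>
      have "card {s' \<in> S - {s}. snd s' = snd s} \<le> card ({..<b0} \<times> {snd s})"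
        by (rule card_mono) (use S(1) in auto)
      then show "real (card {s' \<in> S - {s}. snd s' = snd s}) \<le> real b0" by simp
    qed (use r in auto)
    finally show ?thesis by simp
  qed
  have "real (card S) * (p - real (card S) * (1 / 2) ^ l - real b0 * r) \<le> (\<Sum>s\<in>S. measure ?M (isolated s))"
    using sum_mono[of S "\<lambda>_. p - real (card S) * (1 / 2) ^ l - real b0 * r", OF iso] by simp
  also have "\<dots> = measure_pmf.expectation ?M (\<lambda>\<omega>. \<Sum>s\<in>S. indicator (isolated s) \<omega>)"
    using finite_set_source_space[OF assms(1)]
    by (subst Bochner_Integration.integral_sum) (auto intro: integrable_measure_pmf_finite)
  also have "\<dots> \<le> measure_pmf.expectation ?M (\<lambda>\<omega>. real (card (c \<omega> ` S)))"
  proof (rule integral_mono)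
    show "integrable ?M (\<lambda>\<omega>. \<Sum>s\<in>S. indicator (isolated s) \<omega> :: real)"
      "integrable ?M (\<lambda>\<omega>. real (card (c \<omega> ` S)))"
      using finite_set_source_space[OF assms(1)] by (auto intro: integrable_measure_pmf_finite)
    fix \<omega>
    have "(\<Sum>s\<in>S. indicator (isolated s) \<omega>) = real (card {s \<in> S. \<omega> \<in> isolated s})"
      using fin by (simp add: indicator_def Int_def)
    also have "card {s \<in> S. \<omega> \<in> isolated s} = card (c \<omega> ` {s \<in> S. \<omega> \<in> isolated s})"
      by (rule card_image[symmetric]) (auto simp: inj_on_def isolated_def)
    also have "\<dots> \<le> card (c \<omega> ` S)"
      using fin by (intro card_mono) auto
    finally show "(\<Sum>s\<in>S. indicator (isolated s) \<omega>) \<le> real (card (c \<omega> ` S))" by simp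
  qed
  finally show ?thesis
    by (simp add: c_def r_def p_def algebra_simps)
qed

subsection \<open>The lower bound\<close>

lemma expected_mFLD_bits_eq:
  assumes "0 < A"
  shows "expected_mFLD_bits A B L \<delta> D l =
    measure_pmf.expectation (source_space A B L \<delta>) (\<lambda>\<omega>. real (mFLD_bits D l (concat (blocks \<omega>))))"
  unfolding expected_mFLD_bits_def source_stream_pmf_eq[OF assms] by simp

text \<open>The non-asymptotic form of the bound. \<open>35 \<le> B\<close> ensures
  \<open>B div 8 \<ge> B / 10\<close>, and \<open>18 \<le> l\<close> ensures
  \<open>l - 9 \<ge> l / 2\<close>.\<close>

lemma expected_mFLD_bits_ge:
  assumes "0 < A" "0 < \<delta>" "\<delta> < 1 / 2" "35 \<le> B" "18 \<le> l" "l \<le> L"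
    and entropy: "log 2 (real B / real A) - 2 \<le> real l * binary_entropy \<delta>"
    and p: "3 / 8 \<le> measure (replicate_pmf l (bernoulli_pmf \<delta>)) {z. typical l \<delta> z}"
  shows "1 / 128 * real B * real L \<le> expected_mFLD_bits A B L \<delta> L l"
proof -
  let ?M = "source_space A B L \<delta>"
  define q where "q = L div l"
  define b0 where "b0 = B div 8"
  \<comment> \<open>The cap \<open>2 ^ (l - 5)\<close> keeps the different-origin loss
    \<open>n * (1 / 2) ^ l\<close> at most 1/32.\<close>
  define n where "n = min (b0 * q) (2 ^ (l - 5))"
  \<comment> \<open>Since \<open>q \<ge> 1\<close>, the remainder, being shorter than
    \<open>l\<close>, is shorter than the part covered by full chunks.\<close>
  have q: "q * l \<le> L" "L \<le> 2 * (q * l)"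
  proof -
    show "q * l \<le> L" by (simp add: q_def)
    have "1 \<le> q" using assms(5,6) by (simp add: q_def div_greater_zero_iff Suc_le_eq)
    then have "l \<le> q * l" by simp
    moreover have "L < q * l + l"
      using assms(5) unfolding q_def by (metis add.commute div_mult_mod_eq mod_less_divisor nat_add_left_cancel_less less_le_trans zero_less_numeral)
    ultimately show "L \<le> 2 * (q * l)" by linarith
  qed
  have b0: "b0 \<le> B" "real b0 \<le> real B / 8" "real B / 10 \<le> real b0"
    using assms(4) unfolding b0_def by linarith+
  have "n \<le> card ({..<b0} \<times> {..<q})" by (simp add: n_def)
  then obtain S where S: "S \<subseteq> {..<b0} \<times> {..<q}" "card S = n"
    by (metis obtain_subset_with_card_n)
  define D where "D \<omega> = card ((\<lambda>(b, i). piece l i (blocks \<omega> ! b)) ` S)" for \<omega>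
  define N where "N \<omega> = mFLD_bits L l (concat (blocks \<omega>))" for \<omega>
  have integrable: "integrable ?M f" for f :: "_ \<Rightarrow> real"
    using finite_set_source_space[OF assms(1)] by (rule integrable_measure_pmf_finite)
  have pow: "(2::real) ^ l = 2 ^ (l - 5) * 32" "(2::nat) ^ (l - 5) = 2 ^ (l - 9) * 16"
  proof -
    obtain m where "l = m + 9" using assms(5) le_Suc_ex[of 9 l] by (auto simp: add.commute)
    then have "l - 5 = m + 4" "l - 9 = m" "l = m + 4 + 5" by simp_all
    then show "(2::real) ^ l = 2 ^ (l - 5) * 32" "(2::nat) ^ (l - 5) = 2 ^ (l - 9) * 16"
      by (simp_all add: power_add)
  qed
  \<comment> \<open>The constant is 3/8 for typicality, times 1/2 for surviving same-origin
    collisions, minus 1/32 for different-origin ones.\<close>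
  have ED: "real n * (5 / 32) \<le> measure_pmf.expectation ?M (\<lambda>\<omega>. real (D \<omega>))"
  proof -
    have "2 powr (- real l * binary_entropy \<delta>) \<le> 2 powr (2 - log 2 (real B / real A))"
      using entropy by simp
    also have "\<dots> = 4 * (real A / real B)"
      using assms(1,4) by (simp add: powr_diff)
    finally have "real b0 / real A * 2 powr (- real l * binary_entropy \<delta>) \<le> real b0 / real A * (4 * (real A / real B))"
      by (intro mult_left_mono) auto
    also have "\<dots> = 4 * (real b0 / real B)" using assms(1) by simp
    also have "\<dots> \<le> 1 / 2" using b0 assms(4) by (simp add: field_simps)
    finally have "3 / 8 * (1 / 2) \<le> measure (replicate_pmf l (bernoulli_pmf \<delta>)) {z. typical l \<delta> z} *
        (1 - real b0 / real A * 2 powr (- real l * binary_entropy \<delta>))"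
      using p by (intro mult_mono) auto
    moreover have "real n * (1 / 2) ^ l \<le> 1 / 32"
    proof -
      have "real n \<le> real (2 ^ (l - 5))" unfolding n_def by (intro of_nat_mono) simp
      then show ?thesis using pow(1) by (simp add: power_one_over field_simps)
    qed
    ultimately have "real n * (5 / 32) \<le> real (card S) * (measure (replicate_pmf l (bernoulli_pmf \<delta>)) {z. typical l \<delta> z} *
        (1 - real b0 / real A * 2 powr (- real l * binary_entropy \<delta>)) - real (card S) * (1 / 2) ^ l)"
      unfolding S(2) by (intro mult_left_mono) (linarith, simp)
    also have "\<dots> \<le> measure_pmf.expectation ?M (\<lambda>\<omega>. real (D \<omega>))"
      unfolding D_def by (rule expectation_distinct_pieces_ge[OF assms(1-3) q(1) b0(1) S(1)])
    finally show ?thesis .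
  qed
  have goal: "1 / 128 * real B * real L \<le> real B * real q * real l / 64"
  proof -
    have "real B * real L \<le> real B * real (2 * (q * l))"
      using q(2) by (intro mult_left_mono of_nat_mono) auto
    then show ?thesis by simp
  qed
  have AE: "AE \<omega> in ?M. real (f \<omega>) \<le> real (N \<omega>)"
    if "\<And>\<omega>. \<omega> \<in> set_pmf ?M \<Longrightarrow> f \<omega> \<le> N \<omega>" for f
    using that by (simp add: AE_measure_pmf_iff)
  have "real B * real q * real l / 64 \<le> measure_pmf.expectation ?M (\<lambda>\<omega>. real (N \<omega>))"
  proof (cases "n = b0 * q")
    case True
    have "real B * real q * real l / 64 \<le> real l * (real (b0 * q) * (5 / 32))"
    proof -
      \<comment> \<open>Here \<open>b0 \<ge> B / 10\<close> and \<open>5 / 32 / 10 = 1 / 64\<close>,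
        with equality.\<close>
      have "real B / 64 * (real q * real l) \<le> real b0 * (5 / 32) * (real q * real l)"
        using b0(3) by (intro mult_right_mono) auto
      then show ?thesis by (simp add: mult_ac)
    qed
    also have "\<dots> \<le> real l * measure_pmf.expectation ?M (\<lambda>\<omega>. real (D \<omega>))"
      using ED True by (intro mult_left_mono) auto
    also have "\<dots> = measure_pmf.expectation ?M (\<lambda>\<omega>. real (l * D \<omega>))"
      by simp
    also have "\<dots> \<le> measure_pmf.expectation ?M (\<lambda>\<omega>. real (N \<omega>))"
    proof (intro integral_mono_AE integrable AE)
      fix \<omega> assume \<omega>: "\<omega> \<in> set_pmf ?M"
      note len = length_blocks[OF \<omega> assms(1)]
      have "S \<subseteq> {..<length (blocks \<omega>)} \<times> {..<q}" using S(1) b0(1) len(1) by auto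
      then show "l * D \<omega> \<le> N \<omega>"
        unfolding D_def N_def using assms(5,6) q(1) len(2) by (intro mFLD_bits_ge_distinct) auto
    qed
    finally show ?thesis .
  next
    case False
    then have n: "n = 2 ^ (l - 5)" by (simp add: n_def min_def split: if_splits)
    \<comment> \<open>A reverse Markov argument: \<open>D\<close> never exceeds \<open>n\<close>,
      and it is below \<open>2 ^ (l - 9) = n / 16\<close> outside \<open>T\<close>. Its mean of at
      least \<open>5 * n / 32\<close> then forces \<open>T\<close> to have probability at least
      3/32.\<close>
    define T where "T = {\<omega>. 2 ^ (l - 9) \<le> D \<omega>}"
    have "real n * (5 / 32) \<le> measure_pmf.expectation ?M (\<lambda>\<omega>. real (D \<omega>))" by (rule ED)
    also have "\<dots> \<le> measure_pmf.expectation ?M (\<lambda>\<omega>. real (2 ^ (l - 9)) + real n * indicator T \<omega>)"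
    proof (intro integral_mono integrable)
      fix \<omega>
      have "D \<omega> \<le> n" unfolding D_def S(2)[symmetric]
        using finite_subset[OF S(1)] by (intro card_image_le) auto
      then have "real (D \<omega>) \<le> real n" by simp
      moreover have "real (D \<omega>) \<le> real (2 ^ (l - 9))" if "\<omega> \<notin> T"
        using that unfolding T_def by (intro of_nat_mono) simp
      ultimately show "real (D \<omega>) \<le> real (2 ^ (l - 9)) + real n * indicator T \<omega>"
        by (auto split: split_indicator intro: add_increasing)
    qed
    also have "\<dots> = real (2 ^ (l - 9)) + real n * measure ?M T"
      by (subst Bochner_Integration.integral_add) (auto intro: integrable)
    also have "real (2 ^ (l - 9)) = real n * (2 / 32)"
      unfolding n pow(2) by simp
    finally have "real n * (3 / 32) \<le> real n * measure ?M T" by (simp add: algebra_simps)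
    then have T: "3 / 32 \<le> measure ?M T" unfolding n by simp
    \<comment> \<open>At least half of the blocks remain and each full chunk costs at least
      \<open>l / 2\<close> bits; \<open>1 / 4 * (3 / 32)\<close> exceeds 1/64.\<close>
    have "real B * real q * real l / 64 \<le> real (B - b0) * real q * real (l - 9) * (3 / 32)"
    proof -
      have "real B / 2 * (real l / 2) \<le> real (B - b0) * real (l - 9)"
        using b0 assms(5) by (intro mult_mono) (auto simp: of_nat_diff)
      then have "(real B / 2 * (real l / 2)) * real q \<le> real (B - b0) * real (l - 9) * real q"
        by (rule mult_right_mono) simp
      then have "real B * real q * real l / 4 \<le> real (B - b0) * real q * real (l - 9)"
        by (simp add: mult_ac)
      moreover have "0 \<le> real B * real q * real l" by simp
      ultimately show ?thesis by linarith
    qed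
    also have "\<dots> \<le> real (B - b0) * real q * real (l - 9) * measure ?M T"
      using T by (intro mult_left_mono) auto
    also have "\<dots> = measure_pmf.expectation ?M (\<lambda>\<omega>. real (if \<omega> \<in> T then (l - 9) * (q * (B - b0)) else 0))"
    proof -
      have "(\<lambda>\<omega>. real (if \<omega> \<in> T then (l - 9) * (q * (B - b0)) else 0)) =
          (\<lambda>\<omega>. real (B - b0) * real q * real (l - 9) * indicator T \<omega>)"
        by (auto split: split_indicator)
      then show ?thesis by simp
    qed
    also have "\<dots> \<le> measure_pmf.expectation ?M (\<lambda>\<omega>. real (N \<omega>))"
    proof (intro integral_mono_AE integrable AE)
      fix \<omega> assume \<omega>: "\<omega> \<in> set_pmf ?M"
      note len = length_blocks[OF \<omega> assms(1)]
      have "(l - 9) * (q * (length (blocks \<omega>) - b0)) \<le> N \<omega>" if "\<omega> \<in> T"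
        unfolding N_def
      proof (rule mFLD_bits_ge_pointers)
        show "S \<subseteq> {..<b0} \<times> {..<q}" by (rule S(1))
        show "2 ^ (l - 9) \<le> card ((\<lambda>(b, i). piece l i (blocks \<omega> ! b)) ` S)"
          using that by (simp add: T_def D_def)
      qed (use assms(5,6) q(1) len b0 in auto)
      then show "(if \<omega> \<in> T then (l - 9) * (q * (B - b0)) else 0) \<le> N \<omega>"
        by (simp add: len(1))
    qed
    finally show ?thesis .
  qed
  with goal show ?thesis
    unfolding expected_mFLD_bits_eq[OF assms(1)] N_def by simp
qed

lemma binary_entropy_pos:
  assumes "0 < p" "p < 1"
  shows "0 < binary_entropy p"
  using assms unfolding binary_entropy_def by (intro add_pos_pos mult_pos_pos) auto

text \<open>Choosing \<open>\<epsilon>\<close> before \<open>\<delta>\<close> and \<open>l\<close>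
  expresses that the error term does not depend on \<open>\<delta>\<close>; only the threshold for
  \<open>B\<close> may depend on them. What remains is to show that \<open>l\<close> tends to
  infinity, so that the finite bound applies eventually.\<close>

theorem theorem7:
  fixes A L :: "nat \<Rightarrow> nat" and k1 k2 :: real
  assumes "0 < k2" and "k2 < 1" and "0 < k1"
    and "filterlim A at_top sequentially"
    and "filterlim L at_top sequentially"
    and "\<forall>\<^sub>F B in sequentially. real (A B) \<le> real B powr (1 - k2)"
    and "(\<lambda>B. real (L B)) \<in> \<Theta>(\<lambda>B. real B powr k1)"
  shows "\<exists>\<epsilon> :: nat \<Rightarrow> real. \<epsilon> \<longlonglongrightarrow> 0 \<and>
    (\<forall>(\<delta> :: real) (l :: nat \<Rightarrow> nat).
       0 < \<delta> \<and> \<delta> < 1 / 2 \<and>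
       (\<forall>\<^sub>F B in sequentially. 0 < l B \<and> l B \<le> L B \<and>
          real (l B) \<ge> (log 2 (real B / real (A B)) - 2) / binary_entropy \<delta>) \<longrightarrow>
       (\<forall>\<^sub>F B in sequentially.
          expected_mFLD_bits (A B) B (L B) \<delta> (L B) (l B)
            \<ge> 1 / 128 * real B * real (L B) * (1 + \<epsilon> B)))"
proof (intro exI[of _ "\<lambda>_. 0"] conjI allI impI)
  show "(\<lambda>_::nat. 0::real) \<longlonglongrightarrow> 0" by simp
  fix \<delta> :: real and l :: "nat \<Rightarrow> nat"
  assume *: "0 < \<delta> \<and> \<delta> < 1 / 2 \<and> (\<forall>\<^sub>F B in sequentially. 0 < l B \<and> l B \<le> L B \<and>
          real (l B) \<ge> (log 2 (real B / real (A B)) - 2) / binary_entropy \<delta>)"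
  then have \<delta>: "0 < \<delta>" "\<delta> < 1 / 2" by auto
  from * have l: "\<forall>\<^sub>F B in sequentially. 0 < l B \<and> l B \<le> L B \<and>
          real (l B) \<ge> (log 2 (real B / real (A B)) - 2) / binary_entropy \<delta>" by blast
  have H: "0 < binary_entropy \<delta>" using \<delta> by (intro binary_entropy_pos) auto
  have A: "\<forall>\<^sub>F B in sequentially. 0 < A B"
    using assms(4)[unfolded filterlim_at_top, rule_format, of 1] by (simp add: Suc_le_eq)
  \<comment> \<open>From \<open>A \<le> B powr (1 - k2)\<close> follows
    \<open>log 2 (B / A) \<ge> k2 * log 2 B\<close>, so the assumed lower bound on \<open>l\<close>
    diverges.\<close>
  have "filterlim (\<lambda>B. (k2 * log 2 (real B) - 2) / binary_entropy \<delta>) at_top sequentially"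
    using assms(1) H by real_asymp
  moreover have "\<forall>\<^sub>F B in sequentially. (k2 * log 2 (real B) - 2) / binary_entropy \<delta> \<le> real (l B)"
    using l A assms(6) eventually_gt_at_top[of 0]
  proof eventually_elim
    case (elim B)
    have "real B powr k2 * real (A B) \<le> real B powr k2 * real B powr (1 - k2)"
      using elim(3) by (intro mult_left_mono) auto
    also have "\<dots> = real B" using elim(4) by (simp flip: powr_add)
    finally have "real B powr k2 \<le> real B / real (A B)"
      using elim(2) by (simp add: field_simps)
    then have "log 2 (real B powr k2) \<le> log 2 (real B / real (A B))"
      using elim(2,4) by (subst log_le_cancel_iff) auto
    then have "k2 * log 2 (real B) \<le> log 2 (real B / real (A B))"
      using elim(4) by (simp add: log_powr)
    then have "(k2 * log 2 (real B) - 2) / binary_entropy \<delta> \<le> (log 2 (real B / real (A B)) - 2) / binary_entropy \<delta>"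
      using H by (intro divide_right_mono) auto
    then show ?case using elim(1) by linarith
  qed
  ultimately have "filterlim (\<lambda>B. real (l B)) at_top sequentially"
    by (rule filterlim_at_top_mono)
  then have l_top: "filterlim l at_top sequentially"
    by (simp add: filterlim_sequentially_iff_filterlim_real)
  have "\<forall>\<^sub>F n in sequentially. 3 / 8 \<le> measure (replicate_pmf n (bernoulli_pmf \<delta>)) {z. typical n \<delta> z}"
    unfolding typical_def using \<delta> by (intro eventually_bernoulli_count_ge_mean) auto
  \<comment> \<open>The central limit bound holds for all large list lengths, hence along
    \<open>l B\<close>, because \<open>\<delta>\<close> is fixed while \<open>B\<close>
    grows.\<close>
  then have "\<forall>\<^sub>F B in sequentially. 3 / 8 \<le> measure (replicate_pmf (l B) (bernoulli_pmf \<delta>)) {z. typical (l B) \<delta> z}"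
    using l_top by (rule eventually_compose_filterlim)
  moreover have "\<forall>\<^sub>F B in sequentially. 18 \<le> l B"
    using l_top by (simp add: filterlim_at_top)
  ultimately show "\<forall>\<^sub>F B in sequentially. expected_mFLD_bits (A B) B (L B) \<delta> (L B) (l B)
      \<ge> 1 / 128 * real B * real (L B) * (1 + 0)"
    using l A eventually_ge_at_top[of 35]
  proof eventually_elim
    case (elim B)
    then have "log 2 (real B / real (A B)) - 2 \<le> real (l B) * binary_entropy \<delta>"
      using H by (simp add: pos_divide_le_eq)
    then show ?case
      using expected_mFLD_bits_ge[of "A B" \<delta> B "l B" "L B"] elim \<delta> by simp
  qed
qed

end
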